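(* Let $B$ be a finite skew brace and let $A$ be a subbrace of $B$ contained in $\mathrm{Fix}(B)$. Then $\mathrm{C}_B(A)$ is an ideal of $\mathrm{I}_B(A)$.
   Context: A skew (left) brace is a set $B$ with two group operations $(B,+)$ and $(B,\cdot)$ (neither assumed commutative) such that $a(b+c)=ab-a+ac$ for all $a,b,c\in B$; the two groups share the same identity $0$. The lambda map is $\lambda\colon (B,\cdot)\to\mathrm{Aut}(B,+)$, $\lambda_a(b)=-a+ab$. $\mathrm{Fix}(B)=\{b\in B\mid \lambda_a(b)=b\text{ for all }a\in B\}$. A subbrace of $B$ is a subset that is a subgroup of both $(B,+)$ and $(B,\cdot)$. An ideal of $B$ is a subbrace $I$ with $\lambda_b(I)\subseteq I$ for all $b\in B$ that is normal in both $(B,+)$ and $(B,\cdot)$. For a subbrace $A\subseteq\mathrm{Fix}(B)$ (which is then a left ideal, i.e. $\lambda$-invariant), the centraliser and the idealiser of $A$ are $\mathrm{C}_B(A)=\mathrm{C}_{(B,+)}(A,+)\cap\mathrm{C}_{(B,\cdot)}(A,\cdot)$ and $\mathrm{I}_B(A)=\mathrm{N}_{(B,+)}(A,+)\cap\mathrm{N}_{(B,\cdot)}(A,\cdot)$; it is known that both are subbraces of $B$. *)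

theory Defs
  imports "HOL-Algebra.Algebra"
begin

text \<open>A skew brace is carried by the \<open>ring\<close> record, used purely as a signature:
  \<open>(B,\<cdot>)\<close> is the monoid part of \<open>B\<close> and \<open>(B,+)\<close> is \<open>add_monoid B\<close>. Despite the notation,
  \<open>\<oplus>\<close> need not be commutative.\<close>

locale skew_brace =
  fixes B (structure)
  assumes add_group: "group (add_monoid B)"
    and mult_group: "group B"
    and brace_distrib:
      "\<lbrakk>a \<in> carrier B; b \<in> carrier B; c \<in> carrier B\<rbrakk>
        \<Longrightarrow> a \<otimes> (b \<oplus> c) = ((a \<otimes> b) \<ominus> a) \<oplus> (a \<otimes> c)"

text \<open>The record has separate fields \<open>\<zero>\<close> and \<open>\<one>\<close>, but the axioms force them to agree.\<close>

lemma (in skew_brace) zero_eq_one: "\<zero> = \<one>"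
proof -
  interpret A: group "add_monoid B" by (rule add_group)
  interpret M: group B by (rule mult_group)
  have z: "\<zero> \<in> carrier B" using A.one_closed by simp
  have inv: "\<ominus> \<one> \<in> carrier B"
    using A.inv_closed[of \<one>] by (simp add: a_inv_def)
  have z0: "\<zero> \<oplus> x = x" if "x \<in> carrier B" for x
    using A.l_one[of x] that by simp
  have "\<zero> = \<zero> \<ominus> \<one> \<oplus> \<zero>"
    using brace_distrib[of \<one> \<zero> \<zero>] z z0[OF z] by simp
  also have "\<dots> = \<ominus> \<one>"
    using A.r_one[of "\<ominus> \<one>"] z0[OF inv] inv by (simp add: a_minus_def)
  finally have "\<ominus> \<one> = \<zero>" ..
  then show ?thesis
    using A.r_inv[of \<one>] z0[of \<one>] A.r_one[of \<one>] by (simp add: a_inv_def)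
qed

definition brace_lambda :: "('a, 'm) ring_scheme \<Rightarrow> 'a \<Rightarrow> 'a \<Rightarrow> 'a" where
  "brace_lambda B a b = (\<ominus>\<^bsub>B\<^esub> a) \<oplus>\<^bsub>B\<^esub> (a \<otimes>\<^bsub>B\<^esub> b)"

definition brace_Fix :: "('a, 'm) ring_scheme \<Rightarrow> 'a set" where
  "brace_Fix B = {b \<in> carrier B. \<forall>a \<in> carrier B. brace_lambda B a b = b}"

definition subbrace :: "'a set \<Rightarrow> ('a, 'm) ring_scheme \<Rightarrow> bool" where
  "subbrace A B \<longleftrightarrow> subgroup A (add_monoid B) \<and> subgroup A B"

locale brace_ideal = skew_brace B for I and B (structure) +
  assumes ideal_subbrace: "subbrace I B"
    and ideal_lambda: "b \<in> carrier B \<Longrightarrow> brace_lambda B b ` I \<subseteq> I"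
    and ideal_add_normal: "I \<lhd> add_monoid B"
    and ideal_mult_normal: "I \<lhd> B"

definition group_centraliser :: "('a, 'm) monoid_scheme \<Rightarrow> 'a set \<Rightarrow> 'a set" where
  "group_centraliser G A = {g \<in> carrier G. \<forall>a \<in> A. g \<otimes>\<^bsub>G\<^esub> a = a \<otimes>\<^bsub>G\<^esub> g}"

definition brace_centraliser :: "('a, 'm) ring_scheme \<Rightarrow> 'a set \<Rightarrow> 'a set" where
  "brace_centraliser B A = group_centraliser (add_monoid B) A \<inter> group_centraliser B A"

definition brace_idealiser :: "('a, 'm) ring_scheme \<Rightarrow> 'a set \<Rightarrow> 'a set" where
  "brace_idealiser B A = normalizer (add_monoid B) A \<inter> normalizer B A"

end

theory Submission
  imports Defs
begin

text \<open>Write \<open>N\<^sub>+\<close>, \<open>C\<^sub>+\<close>, \<open>N\<^sub>\<cdot>\<close>, \<open>C\<^sub>\<cdot>\<close> for the normaliser and the centraliser of \<open>A\<close> in the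
  additive and in the multiplicative group, so that the idealiser is \<open>N\<^sub>+ \<inter> N\<^sub>\<cdot>\<close> and the
  centraliser is \<open>C\<^sub>+ \<inter> C\<^sub>\<cdot>\<close>. Everything rests on the identity \<open>b \<cdot> a = b + a\<close> for \<open>a \<in> A\<close>, which
  is what \<open>\<lambda>\<^sub>b(a) = a\<close> means, and on two of its consequences.

  First, the additive automorphisms \<open>\<lambda>\<^sub>b\<close> fix \<open>A\<close> pointwise, hence they preserve \<open>N\<^sub>+\<close> and \<open>C\<^sub>+\<close>,
  and \<open>\<lambda>\<^sub>b(g)\<close> conjugates \<open>A\<close> additively in the same way as \<open>g\<close> does when \<open>g \<in> N\<^sub>+\<close>. As
  \<open>g \<cdot> h = g + \<lambda>\<^sub>g(h)\<close>, the additive conjugation action of \<open>N\<^sub>+\<close> on \<open>A\<close> is a homomorphism for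
  both group operations (\<open>conj_mult_addN\<close>). Its kernel \<open>C\<^sub>+\<close> is therefore normal in \<open>N\<^sub>+\<close> also
  for the multiplication (\<open>addC_mult_normal\<close>); intersecting with \<open>C\<^sub>\<cdot>\<close>, which is normal in \<open>N\<^sub>\<cdot>\<close>,
  gives multiplicative normality.

  Second, the multiplicative conditions can be restated additively: an element \<open>c\<close> of \<open>C\<^sub>+\<close> lies
  in \<open>C\<^sub>\<cdot>\<close> iff \<open>\<lambda>\<^sub>a(c) = c\<close> for all \<open>a \<in> A\<close> (\<open>multC_iff\<close>), and an element \<open>g\<close> of \<open>N\<^sub>+\<close> lies in
  \<open>N\<^sub>\<cdot>\<close> iff \<open>\<lambda>\<^sub>a(g) \<in> A + g\<close> for all \<open>a \<in> A\<close> (\<open>multN_iff\<close>). In this form it is visible that both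
  sets are closed under addition. For \<open>c\<close> in the centraliser and \<open>b\<close> in the idealiser, with
  \<open>\<lambda>\<^sub>a(b) = x + b\<close>, one gets \<open>\<lambda>\<^sub>a(b + c - b) = x + (b + c - b) - x = b + c - b\<close>, since \<open>b + c - b\<close>
  commutes with \<open>x \<in> A\<close>; this is additive normality. Writing \<open>a \<cdot> b = b \<cdot> d\<close> with \<open>d \<in> A\<close> gives
  \<open>\<lambda>\<^sub>a\<lambda>\<^sub>b(c) = \<lambda>\<^sub>b\<lambda>\<^sub>d(c) = \<lambda>\<^sub>b(c)\<close>, which is \<open>\<lambda>\<close>-invariance.\<close>

section \<open>Normalisers and centralisers in a group\<close>

context group
begin

text \<open>The library normaliser is a stabiliser under conjugation of subsets by cosets; working with
  the image of \<open>A\<close> under conjugation avoids the coset notation.\<close>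
lemma mem_normalizer_iff:
  assumes "A \<subseteq> carrier G"
  shows "g \<in> normalizer G A \<longleftrightarrow> g \<in> carrier G \<and> (\<lambda>a. g \<otimes> a \<otimes> inv g) ` A = A"
proof -
  have "g <# A #> inv g = (\<lambda>a. g \<otimes> a \<otimes> inv g) ` A"
    by (auto simp: l_coset_def r_coset_def)
  then show ?thesis
    using assms by (auto simp: normalizer_def stabilizer_def)
qed

lemma normalizer_conj:
  assumes "A \<subseteq> carrier G" "g \<in> normalizer G A" "a \<in> A"
  shows "g \<otimes> a \<otimes> inv g \<in> A"
  using assms by (auto simp: mem_normalizer_iff)

lemma subgroup_group_centraliser:
  assumes "A \<subseteq> carrier G"
  shows "subgroup (group_centraliser G A) G"
proof (rule subgroupI)
  show "group_centraliser G A \<subseteq> carrier G"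
    by (auto simp: group_centraliser_def)
  show "group_centraliser G A \<noteq> {}"
    using assms by (auto simp: group_centraliser_def intro!: exI[of _ \<one>])
next
  fix g assume g: "g \<in> group_centraliser G A"
  have "inv g \<otimes> a = a \<otimes> inv g" if "a \<in> A" for a
  proof -
    have c: "g \<in> carrier G" "a \<in> carrier G" "g \<otimes> a = a \<otimes> g"
      using g that assms by (auto simp: group_centraliser_def)
    have "g \<otimes> (a \<otimes> inv g) = (g \<otimes> a) \<otimes> inv g"
      using c(1,2) by (simp add: m_assoc)
    also have "\<dots> = g \<otimes> (inv g \<otimes> a)"
      unfolding c(3) using c(1,2) by (simp add: m_assoc flip: m_assoc[of g])
    finally show ?thesis
      using c(1,2) by simp
  qed
  then show "inv g \<in> group_centraliser G A"
    using g by (auto simp: group_centraliser_def)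
next
  fix g h assume gh: "g \<in> group_centraliser G A" "h \<in> group_centraliser G A"
  have "g \<otimes> h \<otimes> a = a \<otimes> (g \<otimes> h)" if "a \<in> A" for a
  proof -
    have c: "g \<in> carrier G" "h \<in> carrier G" "a \<in> carrier G" "g \<otimes> a = a \<otimes> g" "h \<otimes> a = a \<otimes> h"
      using gh that assms by (auto simp: group_centraliser_def)
    have "g \<otimes> h \<otimes> a = g \<otimes> a \<otimes> h"
      using c(1-3) by (simp add: m_assoc c(5))
    also have "\<dots> = a \<otimes> (g \<otimes> h)"
      unfolding c(4) using c(1-3) by (simp add: m_assoc)
    finally show ?thesis .
  qed
  then show "g \<otimes> h \<in> group_centraliser G A"
    using gh by (auto simp: group_centraliser_def)
qed

lemma mem_group_centraliser_iff_conj: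
  assumes "A \<subseteq> carrier G"
  shows "g \<in> group_centraliser G A \<longleftrightarrow> g \<in> carrier G \<and> (\<forall>a\<in>A. g \<otimes> a \<otimes> inv g = a)"
proof -
  have "g \<otimes> a = a \<otimes> g \<longleftrightarrow> g \<otimes> a \<otimes> inv g = a" if "g \<in> carrier G" "a \<in> A" for a
    using that assms inv_solve_right'[of a "g \<otimes> a" g] by auto
  then show ?thesis
    by (auto simp: group_centraliser_def)
qed

lemma group_centraliser_subset_normalizer:
  assumes "A \<subseteq> carrier G"
  shows "group_centraliser G A \<subseteq> normalizer G A"
  using assms by (auto simp: mem_group_centraliser_iff_conj mem_normalizer_iff)

lemma conj_mult:
  assumes "g \<in> carrier G" "h \<in> carrier G" "a \<in> carrier G"
  shows "(g \<otimes> h) \<otimes> a \<otimes> inv (g \<otimes> h) = g \<otimes> (h \<otimes> a \<otimes> inv h) \<otimes> inv g"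
  using assms by (simp add: m_assoc inv_mult_group)

text \<open>The centraliser is the kernel of the conjugation action of the normaliser on \<open>A\<close>.\<close>
lemma group_centraliser_conj:
  assumes A: "A \<subseteq> carrier G" and b: "b \<in> normalizer G A" and c: "c \<in> group_centraliser G A"
  shows "b \<otimes> c \<otimes> inv b \<in> group_centraliser G A"
proof -
  have N: "subgroup (normalizer G A) G"
    by (rule normalizer_imp_subgroup[OF A])
  have bc: "b \<in> carrier G" "c \<in> carrier G" "inv b \<in> normalizer G A"
    using b c N by (auto simp: group_centraliser_def subgroup.mem_carrier subgroup.m_inv_closed)
  have "(b \<otimes> c \<otimes> inv b) \<otimes> a \<otimes> inv (b \<otimes> c \<otimes> inv b) = a" if a: "a \<in> A" for a
  proof -
    define a' where "a' = inv b \<otimes> a \<otimes> inv (inv b)"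
    have a': "a' \<in> A" "a \<in> carrier G" "a' \<in> carrier G"
      using normalizer_conj[OF A bc(3) a] a A unfolding a'_def by auto
    have "(b \<otimes> c \<otimes> inv b) \<otimes> a \<otimes> inv (b \<otimes> c \<otimes> inv b) = b \<otimes> (c \<otimes> a' \<otimes> inv c) \<otimes> inv b"
      using bc a' conj_mult[of "b \<otimes> c" "inv b" a] conj_mult[of b c a'] by (simp add: a'_def)
    also have "\<dots> = b \<otimes> a' \<otimes> inv b"
      using c a' A by (simp add: mem_group_centraliser_iff_conj)
    also have "\<dots> = a"
      using bc a' conj_mult[of b "inv b" a] by (simp add: a'_def)
    finally show ?thesis .
  qed
  then show ?thesis
    using bc A by (simp add: mem_group_centraliser_iff_conj)
qed

end

section \<open>The lambda map of a skew brace\<close>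

sublocale skew_brace \<subseteq> add: group "add_monoid B"
  rewrites "carrier (add_monoid B) = carrier B"
    and "monoid.mult (add_monoid B) = ring.add B"
    and "monoid.one (add_monoid B) = \<zero>\<^bsub>B\<^esub>"
    and "m_inv (add_monoid B) = a_inv B"
  by (rule add_group) (auto simp: a_inv_def)

sublocale skew_brace \<subseteq> mult: group B
  by (rule mult_group)

context skew_brace
begin

abbreviation lam :: "'a \<Rightarrow> 'a \<Rightarrow> 'a" where
  "lam \<equiv> brace_lambda B"

lemma lambda_closed [simp]:
  "a \<in> carrier B \<Longrightarrow> b \<in> carrier B \<Longrightarrow> lam a b \<in> carrier B"
  by (simp add: brace_lambda_def)

lemma mult_eq_add_lambda:
  "a \<in> carrier B \<Longrightarrow> b \<in> carrier B \<Longrightarrow> a \<otimes> b = a \<oplus> lam a b"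
  by (simp add: brace_lambda_def flip: add.m_assoc)

lemma lambda_add:
  assumes "a \<in> carrier B" "b \<in> carrier B" "c \<in> carrier B"
  shows "lam a (b \<oplus> c) = lam a b \<oplus> lam a c"
  using assms by (simp add: brace_lambda_def brace_distrib a_minus_def add.m_assoc)

lemma lambda_minus:
  assumes "a \<in> carrier B" "b \<in> carrier B"
  shows "lam a (\<ominus> b) = \<ominus> lam a b"
proof -
  have "lam a \<in> hom (add_monoid B) (add_monoid B)"
    using assms by (auto simp: hom_def lambda_add)
  then interpret h: group_hom "add_monoid B" "add_monoid B" "lam a"
    by (simp add: group_hom_def group_hom_axioms_def add_group)
  show ?thesis
    using h.hom_inv[of b] assms by (simp add: a_inv_def)
qed

lemma lambda_mult:
  assumes "a \<in> carrier B" "b \<in> carrier B" "c \<in> carrier B"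
  shows "lam (a \<otimes> b) c = lam a (lam b c)"
proof -
  have "a \<otimes> b \<oplus> lam (a \<otimes> b) c = a \<otimes> (b \<otimes> c)"
    using assms by (simp add: mult.m_assoc flip: mult_eq_add_lambda)
  also have "\<dots> = a \<oplus> (lam a b \<oplus> lam a (lam b c))"
    using assms by (simp add: mult_eq_add_lambda lambda_add)
  also have "\<dots> = a \<otimes> b \<oplus> lam a (lam b c)"
    using assms by (simp add: mult_eq_add_lambda add.m_assoc)
  finally show ?thesis
    using assms by simp
qed

text \<open>This follows from \<open>0 = a\<^sup>-\<^sup>1 \<cdot> a = a\<^sup>-\<^sup>1 + \<lambda>(a)\<close>, where \<open>\<lambda>\<close> belongs to \<open>a\<^sup>-\<^sup>1\<close>. It expresses
  multiplicative inverses by \<open>\<lambda>\<close> and the additive group alone.\<close>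
lemma inv_eq_lambda_minus:
  assumes "a \<in> carrier B"
  shows "inv a = lam (inv a) (\<ominus> a)"
proof -
  have "lam (inv a) a = \<ominus> (inv a)"
    using assms by (simp add: brace_lambda_def flip: zero_eq_one)
  then show ?thesis
    using assms by (simp add: lambda_minus)
qed

text \<open>In a left ideal, both \<open>a \<cdot> b = a + \<lambda>\<^sub>a(b)\<close> and the multiplicative inverse are obtained from
  elements of \<open>H\<close> by additive operations and \<open>\<lambda>\<close>.\<close>
lemma left_ideal_subgroup_mult:
  assumes H: "subgroup H (add_monoid B)"
    and lam: "\<And>b h. b \<in> carrier B \<Longrightarrow> h \<in> H \<Longrightarrow> lam b h \<in> H"
  shows "subgroup H B"
proof (rule mult.subgroupI)
  interpret H: subgroup H "add_monoid B" by (rule H)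
  show sub: "H \<subseteq> carrier B" using H.subset by simp
  show "H \<noteq> {}" using H.one_closed by auto
  have carr: "a \<in> carrier B" if "a \<in> H" for a
    using that sub by (rule rev_subsetD)
  show "inv a \<in> H" if a: "a \<in> H" for a
  proof -
    have "\<ominus> a \<in> H"
      using H.m_inv_closed[OF a] by (simp add: a_inv_def)
    then have "lam (inv a) (\<ominus> a) \<in> H"
      by (rule lam[OF mult.inv_closed[OF carr[OF a]]])
    then show ?thesis
      by (simp only: inv_eq_lambda_minus[OF carr[OF a], symmetric])
  qed
  show "a \<otimes> b \<in> H" if ab: "a \<in> H" "b \<in> H" for a b
    using H.m_closed[OF ab(1) lam[OF carr[OF ab(1)] ab(2)]] carr[OF ab(1)] carr[OF ab(2)]
    by (simp add: mult_eq_add_lambda)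
qed

section \<open>Subbraces as skew braces\<close>

lemma add_monoid_restrict: "add_monoid (B\<lparr>carrier := H\<rparr>) = (add_monoid B)\<lparr>carrier := H\<rparr>"
  by simp

lemma a_inv_restrict:
  assumes "subbrace H B" "x \<in> H"
  shows "\<ominus>\<^bsub>B\<lparr>carrier := H\<rparr>\<^esub> x = \<ominus> x"
  using assms group.m_inv_consistent[OF add_group, of H x]
  by (simp add: a_inv_def add_monoid_restrict subbrace_def)

lemma lambda_restrict:
  assumes "subbrace H B" "x \<in> H"
  shows "brace_lambda (B\<lparr>carrier := H\<rparr>) x y = lam x y"
  using assms by (simp add: brace_lambda_def a_inv_restrict)

lemma skew_brace_subbrace:
  assumes "subbrace H B"
  shows "skew_brace (B\<lparr>carrier := H\<rparr>)"
proof (rule skew_brace.intro)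
  have H: "subgroup H (add_monoid B)" "subgroup H B"
    using assms by (auto simp: subbrace_def)
  show "Group.group (add_monoid (B\<lparr>carrier := H\<rparr>))"
    unfolding add_monoid_restrict
    by (rule subgroup.subgroup_is_group[OF H(1) add_group])
  show "Group.group (B\<lparr>carrier := H\<rparr>)"
    by (rule subgroup.subgroup_is_group[OF H(2) mult_group])
  fix a b c
  assume "a \<in> carrier (B\<lparr>carrier := H\<rparr>)" "b \<in> carrier (B\<lparr>carrier := H\<rparr>)" "c \<in> carrier (B\<lparr>carrier := H\<rparr>)"
  then show "a \<otimes>\<^bsub>B\<lparr>carrier := H\<rparr>\<^esub> (b \<oplus>\<^bsub>B\<lparr>carrier := H\<rparr>\<^esub> c) =
    (a \<otimes>\<^bsub>B\<lparr>carrier := H\<rparr>\<^esub> b \<ominus>\<^bsub>B\<lparr>carrier := H\<rparr>\<^esub> a) \<oplus>\<^bsub>B\<lparr>carrier := H\<rparr>\<^esub> (a \<otimes>\<^bsub>B\<lparr>carrier := H\<rparr>\<^esub> c)"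
    using assms subgroup.mem_carrier[OF H(2)] brace_distrib[of a b c]
    by (simp add: a_minus_def a_inv_restrict)
qed

text \<open>Translates the ideal axioms, which speak of the operations of the restricted structure, into
  conditions on the operations of the ambient brace.\<close>
lemma brace_ideal_in_subbrace:
  assumes H: "subbrace H B" and I: "subbrace I B" "I \<subseteq> H"
    and lam: "\<And>b c. b \<in> H \<Longrightarrow> c \<in> I \<Longrightarrow> lam b c \<in> I"
    and add: "\<And>b c. b \<in> H \<Longrightarrow> c \<in> I \<Longrightarrow> b \<oplus> c \<oplus> \<ominus> b \<in> I"
    and mult: "\<And>b c. b \<in> H \<Longrightarrow> c \<in> I \<Longrightarrow> b \<otimes> c \<otimes> inv b \<in> I"
  shows "brace_ideal I (B\<lparr>carrier := H\<rparr>)"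
proof -
  let ?H = "B\<lparr>carrier := H\<rparr>"
  interpret S: skew_brace ?H by (rule skew_brace_subbrace[OF H])
  have HG: "subgroup H (add_monoid B)" "subgroup H B" "subgroup I (add_monoid B)" "subgroup I B"
    using H I by (auto simp: subbrace_def)
  have sub: "subgroup I (add_monoid ?H)" "subgroup I ?H"
    unfolding add_monoid_restrict
    using group.subgroup_incl[OF add_group HG(3,1) I(2)] mult.subgroup_incl[OF HG(4,2) I(2)] by auto
  show ?thesis
  proof (intro brace_ideal.intro brace_ideal_axioms.intro S.skew_brace_axioms)
    show "subbrace I ?H"
      using sub by (simp add: subbrace_def)
    show "brace_lambda ?H b ` I \<subseteq> I" if "b \<in> carrier ?H" for b
      using that lam H by (auto simp: lambda_restrict)
    show "I \<lhd> add_monoid ?H"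
      unfolding group.normal_inv_iff[OF S.add_group]
      using sub add a_inv_restrict[OF H] by (simp add: a_inv_def)
    show "I \<lhd> ?H"
      unfolding group.normal_inv_iff[OF S.mult_group]
      using sub mult mult.m_inv_consistent[OF HG(2)] by simp
  qed
qed

end

section \<open>Subbraces of fixed points\<close>

locale fixed_subbrace = skew_brace +
  fixes A
  assumes A_subbrace: "subbrace A B"
    and A_fixed: "A \<subseteq> brace_Fix B"
begin

abbreviation "addN \<equiv> normalizer (add_monoid B) A"
abbreviation "addC \<equiv> group_centraliser (add_monoid B) A"
abbreviation "multN \<equiv> normalizer B A"
abbreviation "multC \<equiv> group_centraliser B A"

lemma A_add_subgroup: "subgroup A (add_monoid B)"
  and A_mult_subgroup: "subgroup A B"
  using A_subbrace by (auto simp: subbrace_def)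

lemma A_carrier: "A \<subseteq> carrier B"
  using A_mult_subgroup by (rule subgroup.subset)

lemma A_closed [simp]: "a \<in> A \<Longrightarrow> a \<in> carrier B"
  using A_carrier by auto

lemma A_add_closed: "a \<in> A \<Longrightarrow> b \<in> A \<Longrightarrow> a \<oplus> b \<in> A"
  using subgroup.m_closed[OF A_add_subgroup] by simp

lemma A_minus_closed: "a \<in> A \<Longrightarrow> \<ominus> a \<in> A"
  using subgroup.m_inv_closed[OF A_add_subgroup] by (simp add: a_inv_def)

lemma lambda_A: "b \<in> carrier B \<Longrightarrow> a \<in> A \<Longrightarrow> lam b a = a"
  using A_fixed by (auto simp: brace_Fix_def)

lemma mult_A: "b \<in> carrier B \<Longrightarrow> a \<in> A \<Longrightarrow> b \<otimes> a = b \<oplus> a"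
  by (simp add: mult_eq_add_lambda lambda_A)

lemma addN_carrier: "g \<in> addN \<Longrightarrow> g \<in> carrier B"
  using add.mem_normalizer_iff[of A] A_carrier by simp

lemma addC_carrier: "g \<in> addC \<Longrightarrow> g \<in> carrier B"
  by (simp add: group_centraliser_def)

lemma multN_carrier: "g \<in> multN \<Longrightarrow> g \<in> carrier B"
  using mult.mem_normalizer_iff[of A] A_carrier by simp

section \<open>Additive conjugation on the subbrace\<close>

lemma lambda_conj:
  assumes "b \<in> carrier B" "g \<in> carrier B" "a \<in> A"
  shows "lam b g \<oplus> a \<oplus> \<ominus> lam b g = lam b (g \<oplus> a \<oplus> \<ominus> g)"
  using assms by (simp add: lambda_add lambda_minus lambda_A)

text \<open>The conjugate of \<open>a\<close> by \<open>g\<close> lies in \<open>A\<close>, so it is fixed by \<open>\<lambda>\<^sub>b\<close>.\<close>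
lemma lambda_conj_addN:
  assumes "b \<in> carrier B" "g \<in> addN" "a \<in> A"
  shows "lam b g \<oplus> a \<oplus> \<ominus> lam b g = g \<oplus> a \<oplus> \<ominus> g"
  using assms add.normalizer_conj[of A g a] A_carrier addN_carrier
  by (simp add: lambda_conj lambda_A)

lemma lambda_addN:
  assumes "b \<in> carrier B" "g \<in> addN"
  shows "lam b g \<in> addN"
  using assms add.mem_normalizer_iff[of A] A_carrier addN_carrier
  by (simp add: lambda_conj_addN cong: image_cong)

lemma lambda_addC:
  assumes "b \<in> carrier B" "c \<in> addC"
  shows "lam b c \<in> addC"
  using assms add.mem_group_centraliser_iff_conj[of A] A_carrier addC_carrier
  by (simp add: lambda_conj lambda_A)

lemma addN_subgroups: "subgroup addN (add_monoid B)" "subgroup addN B"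
proof -
  show "subgroup addN (add_monoid B)"
    using add.normalizer_imp_subgroup A_carrier by simp
  then show "subgroup addN B"
    by (rule left_ideal_subgroup_mult) (rule lambda_addN)
qed

lemma addC_subgroups: "subgroup addC (add_monoid B)" "subgroup addC B"
proof -
  show "subgroup addC (add_monoid B)"
    using add.subgroup_group_centraliser A_carrier by simp
  then show "subgroup addC B"
    by (rule left_ideal_subgroup_mult) (rule lambda_addC)
qed

text \<open>Additive conjugation on \<open>A\<close> is an action of the multiplicative group of \<open>N\<^sub>+\<close> too, because
  \<open>g \<cdot> h = g + \<lambda>\<^sub>g(h)\<close> and \<open>\<lambda>\<^sub>g(h)\<close> acts like \<open>h\<close>.\<close>
lemma conj_mult_addN:
  assumes "g \<in> addN" "h \<in> addN" "a \<in> A"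
  shows "(g \<otimes> h) \<oplus> a \<oplus> \<ominus> (g \<otimes> h) = g \<oplus> (h \<oplus> a \<oplus> \<ominus> h) \<oplus> \<ominus> g"
  using assms addN_carrier
  by (simp add: mult_eq_add_lambda add.conj_mult lambda_conj_addN)

text \<open>\<open>C\<^sub>+\<close> is the kernel of the additive conjugation action, which by \<open>conj_mult_addN\<close> is also
  multiplicative.\<close>
lemma addC_mult_normal:
  assumes b: "b \<in> addN" and c: "c \<in> addC"
  shows "b \<otimes> c \<otimes> inv b \<in> addC"
proof -
  interpret N: subgroup addN B by (rule addN_subgroups)
  have cN: "c \<in> addN"
    using c add.group_centraliser_subset_normalizer[of A] A_carrier by auto
  have bN: "inv b \<in> addN" using b by (rule N.m_inv_closed)
  have "(b \<otimes> c \<otimes> inv b) \<oplus> a \<oplus> \<ominus> (b \<otimes> c \<otimes> inv b) = a" if a: "a \<in> A" for a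
  proof -
    define a' where "a' = inv b \<oplus> a \<oplus> \<ominus> (inv b)"
    have a': "a' \<in> A"
      unfolding a'_def using add.normalizer_conj[of A "inv b" a] bN a A_carrier by simp
    have "(b \<otimes> c \<otimes> inv b) \<oplus> a \<oplus> \<ominus> (b \<otimes> c \<otimes> inv b) = b \<oplus> (c \<oplus> a' \<oplus> \<ominus> c) \<oplus> \<ominus> b"
      using b cN bN a a' conj_mult_addN[of "b \<otimes> c" "inv b" a] conj_mult_addN[of b c a']
      by (simp add: a'_def)
    also have "\<dots> = b \<oplus> a' \<oplus> \<ominus> b"
      using c a' A_carrier add.mem_group_centraliser_iff_conj[of A] by simp
    also have "\<dots> = (b \<otimes> inv b) \<oplus> a \<oplus> \<ominus> (b \<otimes> inv b)"
      using b bN a by (simp only: conj_mult_addN a'_def)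
    also have "\<dots> = a"
      using b a addN_carrier by (simp flip: zero_eq_one)
    finally show ?thesis .
  qed
  then show ?thesis
    using b bN cN addN_carrier A_carrier add.mem_group_centraliser_iff_conj[of A] by simp
qed

section \<open>Additive forms of the multiplicative conditions\<close>

text \<open>Compare \<open>c \<cdot> a = c + a = a + c\<close> with \<open>a \<cdot> c = a + \<lambda>\<^sub>a(c)\<close>.\<close>
lemma multC_iff:
  assumes c: "c \<in> addC"
  shows "c \<in> multC \<longleftrightarrow> (\<forall>a\<in>A. lam a c = c)"
proof -
  have "c \<otimes> a = a \<otimes> c \<longleftrightarrow> lam a c = c" if a: "a \<in> A" for a
  proof -
    have "c \<otimes> a = a \<oplus> c"
      using c a by (simp add: mult_A group_centraliser_def)
    moreover have "a \<otimes> c = a \<oplus> lam a c"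
      using c a addC_carrier by (simp add: mult_eq_add_lambda)
    ultimately show ?thesis
      using c a addC_carrier by auto
  qed
  then show ?thesis
    using c by (auto simp: group_centraliser_def)
qed

lemma multN_swap:
  assumes g: "g \<in> multN" and a: "a \<in> A"
  obtains a' where "a' \<in> A" "a \<otimes> g = g \<otimes> a'"
proof -
  have gc: "g \<in> carrier B" and "a \<in> (\<lambda>a. g \<otimes> a \<otimes> inv g) ` A"
    using g a mult.mem_normalizer_iff[of A g] A_carrier by auto
  then obtain a' where "a' \<in> A" "a = g \<otimes> a' \<otimes> inv g"
    by auto
  with gc show ?thesis
    by (intro that[of a']) (auto simp: mult.m_assoc)
qed

text \<open>Since \<open>a \<cdot> g = a + \<lambda>\<^sub>a(g)\<close> and \<open>g \<cdot> A = g + A = A + g\<close>, the right-hand side says that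
  \<open>A \<cdot> g \<subseteq> g \<cdot> A\<close>. Finiteness turns this inclusion into an equality.\<close>
lemma multN_iff:
  assumes g: "g \<in> addN" and fin: "finite (carrier B)"
  shows "g \<in> multN \<longleftrightarrow> (\<forall>a\<in>A. \<exists>x\<in>A. lam a g = x \<oplus> g)"
proof
  assume gm: "g \<in> multN"
  show "\<forall>a\<in>A. \<exists>x\<in>A. lam a g = x \<oplus> g"
  proof
    fix a assume a: "a \<in> A"
    obtain a' where a': "a' \<in> A" "a \<otimes> g = g \<otimes> a'"
      by (rule multN_swap[OF gm a])
    have gc: "g \<in> carrier B" using g by (rule addN_carrier)
    define y where "y = g \<oplus> a' \<oplus> \<ominus> g"
    have y: "y \<in> A"
      unfolding y_def using add.normalizer_conj[of A g a'] g a' A_carrier by simp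
    have "lam a g = \<ominus> a \<oplus> (g \<oplus> a')"
      using a' a gc by (simp add: brace_lambda_def mult_A)
    also have "g \<oplus> a' = y \<oplus> g"
      using a' gc by (simp add: y_def add.m_assoc)
    finally have "lam a g = (\<ominus> a \<oplus> y) \<oplus> g"
      using a y gc by (simp add: add.m_assoc)
    then show "\<exists>x\<in>A. lam a g = x \<oplus> g"
      using a y by (auto intro!: bexI[of _ "\<ominus> a \<oplus> y"] A_add_closed A_minus_closed)
  qed
next
  assume *: "\<forall>a\<in>A. \<exists>x\<in>A. lam a g = x \<oplus> g"
  have gc: "g \<in> carrier B" using g by (rule addN_carrier)
  have gN: "\<ominus> g \<in> addN"
    using subgroup.m_inv_closed[OF addN_subgroups(1) g] by (simp add: a_inv_def)
  have swap: "inv g \<otimes> a \<otimes> g \<in> A" if a: "a \<in> A" for a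
  proof -
    obtain x where x: "x \<in> A" "lam a g = x \<oplus> g"
      using * a by auto
    define y where "y = \<ominus> g \<oplus> (a \<oplus> x) \<oplus> g"
    have y: "y \<in> A"
      unfolding y_def
      using add.normalizer_conj[of A "\<ominus> g" "a \<oplus> x"] gN A_carrier A_add_closed[OF a x(1)] gc by simp
    have "a \<otimes> g = a \<oplus> x \<oplus> g"
      using a x gc by (simp add: mult_eq_add_lambda add.m_assoc)
    also have "\<dots> = g \<oplus> y"
      using a x gc by (simp add: y_def flip: add.m_assoc)
    also have "\<dots> = g \<otimes> y"
      using y gc by (simp add: mult_A)
    finally have "inv g \<otimes> a \<otimes> g = y"
      using a y gc by (simp add: mult.m_assoc flip: mult.inv_solve_left')
    then show ?thesis using y by simp
  qed
  \<comment> \<open>An injective map of the finite set \<open>A\<close> into itself is onto.\<close>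
  have "(\<lambda>a. inv g \<otimes> a \<otimes> inv (inv g)) ` A = A"
  proof (rule endo_inj_surj)
    show "finite A" using fin A_carrier by (rule rev_finite_subset)
    show "(\<lambda>a. inv g \<otimes> a \<otimes> inv (inv g)) ` A \<subseteq> A" using swap gc by auto
    show "inj_on (\<lambda>a. inv g \<otimes> a \<otimes> inv (inv g)) A" using gc by (auto intro!: inj_onI)
  qed
  then have "inv g \<in> multN"
    using gc A_carrier mult.mem_normalizer_iff[of A "inv g"] by simp
  then have "inv (inv g) \<in> multN"
    using subgroup.m_inv_closed[OF mult.normalizer_imp_subgroup[OF A_carrier]] by blast
  then show "g \<in> multN" using gc by simp
qed

section \<open>The centraliser and the idealiser\<close>

text \<open>Within \<open>C\<^sub>+\<close>, membership in \<open>C\<^sub>\<cdot>\<close> means being fixed by additive automorphisms, a condition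
  closed under addition.\<close>
lemma subbrace_brace_centraliser: "subbrace (brace_centraliser B A) B"
proof -
  interpret C: subgroup addC "add_monoid B" by (rule addC_subgroups)
  have "subgroup (addC \<inter> multC) (add_monoid B)"
  proof (rule group.subgroupI[OF add_group])
    show "addC \<inter> multC \<subseteq> carrier (add_monoid B)"
      using C.subset by auto
    have "\<zero> \<in> multC"
      by (simp add: zero_eq_one group_centraliser_def)
    then show "addC \<inter> multC \<noteq> {}"
      using C.one_closed by auto
    show "inv\<^bsub>add_monoid B\<^esub> c \<in> addC \<inter> multC" if "c \<in> addC \<inter> multC" for c
      using that C.m_inv_closed[of c] multC_iff[of c] multC_iff[of "\<ominus> c"] addC_carrier
      by (simp add: a_inv_def[symmetric] lambda_minus)
    show "c \<otimes>\<^bsub>add_monoid B\<^esub> d \<in> addC \<inter> multC" if "c \<in> addC \<inter> multC" "d \<in> addC \<inter> multC" for c d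
      using that C.m_closed[of c d] multC_iff[of c] multC_iff[of d] multC_iff[of "c \<oplus> d"] addC_carrier
      by (simp add: lambda_add)
  qed
  moreover have "subgroup (addC \<inter> multC) B"
    by (intro mult.subgroups_Inter_pair addC_subgroups mult.subgroup_group_centraliser A_carrier)
  ultimately show ?thesis
    by (simp add: subbrace_def brace_centraliser_def)
qed

text \<open>By \<open>multN_iff\<close>, the elements \<open>g\<close> of \<open>N\<^sub>+\<close> in question are those with \<open>\<lambda>\<^sub>a(g) \<in> A + g\<close>. If
  \<open>\<lambda>\<^sub>a(g) = x + g\<close> and \<open>\<lambda>\<^sub>a(h) = y + h\<close>, then \<open>\<lambda>\<^sub>a(g + h) = x + g + y + h\<close>, and \<open>g\<close> can be moved past
  \<open>y\<close> because it normalises \<open>A\<close> additively; negatives are treated in the same way.\<close>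
lemma subbrace_brace_idealiser:
  assumes fin: "finite (carrier B)"
  shows "subbrace (brace_idealiser B A) B"
proof -
  interpret N: subgroup addN "add_monoid B" by (rule addN_subgroups)
  have multN: "subgroup multN B"
    by (rule mult.normalizer_imp_subgroup[OF A_carrier])
  have "subgroup (addN \<inter> multN) (add_monoid B)"
  proof (rule group.subgroupI[OF add_group])
    show "addN \<inter> multN \<subseteq> carrier (add_monoid B)"
      using N.subset by auto
    have "\<zero> \<in> multN"
      using subgroup.one_closed[OF multN] by (simp add: zero_eq_one)
    then show "addN \<inter> multN \<noteq> {}"
      using N.one_closed by auto
  next
    fix g assume g: "g \<in> addN \<inter> multN"
    have gc: "g \<in> carrier B" using g addN_carrier by auto
    have gN: "\<ominus> g \<in> addN" using g N.m_inv_closed[of g] by (simp add: a_inv_def)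
    have "\<exists>y\<in>A. lam a (\<ominus> g) = y \<oplus> \<ominus> g" if a: "a \<in> A" for a
    proof -
      obtain x where x: "x \<in> A" "lam a g = x \<oplus> g"
        using g a multN_iff[OF _ fin] by auto
      define y where "y = \<ominus> g \<oplus> \<ominus> x \<oplus> g"
      have "y \<in> A"
        unfolding y_def
        using add.normalizer_conj[of A "\<ominus> g" "\<ominus> x"] gN A_carrier A_minus_closed[OF x(1)] gc by simp
      moreover have "lam a (\<ominus> g) = y \<oplus> \<ominus> g"
        using x a gc by (simp add: lambda_minus y_def add.inv_mult_group add.m_assoc)
      ultimately show ?thesis by blast
    qed
    then show "inv\<^bsub>add_monoid B\<^esub> g \<in> addN \<inter> multN"
      using gN multN_iff[OF gN fin] by (simp add: a_inv_def[symmetric])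
  next
    fix g h assume gh: "g \<in> addN \<inter> multN" "h \<in> addN \<inter> multN"
    have c: "g \<in> carrier B" "h \<in> carrier B" using gh addN_carrier by auto
    have ghN: "g \<oplus> h \<in> addN" using gh N.m_closed[of g h] by simp
    have "\<exists>z\<in>A. lam a (g \<oplus> h) = z \<oplus> (g \<oplus> h)" if a: "a \<in> A" for a
    proof -
      obtain x y where x: "x \<in> A" "lam a g = x \<oplus> g" and y: "y \<in> A" "lam a h = y \<oplus> h"
        using gh a multN_iff[OF _ fin] by (meson IntD1 IntD2)
      define y' where "y' = g \<oplus> y \<oplus> \<ominus> g"
      have y': "y' \<in> A"
        unfolding y'_def using add.normalizer_conj[of A g y] gh y A_carrier by simp
      have "lam a (g \<oplus> h) = x \<oplus> (g \<oplus> y) \<oplus> h"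
        using x y a c by (simp add: lambda_add add.m_assoc)
      also have "g \<oplus> y = y' \<oplus> g"
        using y c by (simp add: y'_def add.m_assoc)
      finally have "lam a (g \<oplus> h) = (x \<oplus> y') \<oplus> (g \<oplus> h)"
        using x y' c by (simp add: add.m_assoc)
      then show ?thesis
        using A_add_closed[OF x(1) y'] by blast
    qed
    then show "g \<otimes>\<^bsub>add_monoid B\<^esub> h \<in> addN \<inter> multN"
      using ghN multN_iff[OF ghN fin] by simp
  qed
  moreover have "subgroup (addN \<inter> multN) B"
    by (intro mult.subgroups_Inter_pair addN_subgroups multN)
  ultimately show ?thesis
    by (simp add: subbrace_def brace_idealiser_def)
qed

lemma brace_centraliser_subset_idealiser: "brace_centraliser B A \<subseteq> brace_idealiser B A"
  using add.group_centraliser_subset_normalizer[of A] mult.group_centraliser_subset_normalizer[of A] A_carrier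
  by (auto simp: brace_centraliser_def brace_idealiser_def)

text \<open>Moving \<open>a\<close> past \<open>b\<close> replaces it by another element of \<open>A\<close>, and all of these fix \<open>c\<close> under
  \<open>\<lambda>\<close>.\<close>
lemma lambda_brace_centraliser:
  assumes b: "b \<in> multN" and c: "c \<in> brace_centraliser B A"
  shows "lam b c \<in> brace_centraliser B A"
proof -
  have c': "c \<in> addC" "c \<in> multC" and cc: "c \<in> carrier B" "b \<in> carrier B"
    using b c addC_carrier multN_carrier by (auto simp: brace_centraliser_def)
  have "lam a (lam b c) = lam b c" if a: "a \<in> A" for a
  proof -
    obtain a' where a': "a' \<in> A" "a \<otimes> b = b \<otimes> a'"
      by (rule multN_swap[OF b a])
    have "lam a (lam b c) = lam (b \<otimes> a') c"
      using a cc by (simp add: a'(2) flip: lambda_mult)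
    also have "\<dots> = lam b c"
      using a' cc c' multC_iff by (simp add: lambda_mult)
    finally show ?thesis .
  qed
  then show ?thesis
    using lambda_addC[OF cc(2) c'(1)] multC_iff by (simp add: brace_centraliser_def)
qed

text \<open>The automorphism \<open>\<lambda>\<^sub>a\<close> changes \<open>b\<close> only by a summand \<open>x \<in> A\<close> on the left, and conjugation by
  \<open>x\<close> is trivial on \<open>b + c - b \<in> C\<^sub>+\<close>.\<close>
lemma brace_centraliser_add_normal:
  assumes fin: "finite (carrier B)"
    and b: "b \<in> brace_idealiser B A" and c: "c \<in> brace_centraliser B A"
  shows "b \<oplus> c \<oplus> \<ominus> b \<in> brace_centraliser B A"
proof -
  have c': "c \<in> addC" "c \<in> multC" and b': "b \<in> addN" "b \<in> multN"
    and cc: "c \<in> carrier B" "b \<in> carrier B"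
    using b c addC_carrier addN_carrier by (auto simp: brace_centraliser_def brace_idealiser_def)
  let ?d = "b \<oplus> c \<oplus> \<ominus> b"
  have d: "?d \<in> addC"
    using add.group_centraliser_conj[of A b c] A_carrier b' c' by simp
  have "lam a ?d = ?d" if a: "a \<in> A" for a
  proof -
    obtain x where x: "x \<in> A" "lam a b = x \<oplus> b"
      using b' a multN_iff[OF _ fin] by auto
    have "lam a ?d = x \<oplus> b \<oplus> c \<oplus> \<ominus> (x \<oplus> b)"
      using x a cc c' multC_iff by (simp add: lambda_add lambda_minus)
    also have "\<dots> = x \<oplus> ?d \<oplus> \<ominus> x"
      using x cc by (simp add: add.conj_mult)
    also have "\<dots> = ?d \<oplus> x \<oplus> \<ominus> x"
      using d x by (simp add: group_centraliser_def)
    also have "\<dots> = ?d"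
      using x cc by (simp add: add.m_assoc)
    finally show ?thesis .
  qed
  then show ?thesis
    using d multC_iff by (simp add: brace_centraliser_def)
qed

lemma brace_centraliser_mult_normal:
  assumes "b \<in> brace_idealiser B A" "c \<in> brace_centraliser B A"
  shows "b \<otimes> c \<otimes> inv b \<in> brace_centraliser B A"
  using assms addC_mult_normal mult.group_centraliser_conj[OF A_carrier]
  by (simp add: brace_centraliser_def brace_idealiser_def)

end

theorem theorem3p1:
  fixes B :: "('a, 'm) ring_scheme" and A :: "'a set"
  assumes "skew_brace B"
    and "finite (carrier B)"
    and "subbrace A B"
    and "A \<subseteq> brace_Fix B"
  shows "brace_ideal (brace_centraliser B A) (B\<lparr>carrier := brace_idealiser B A\<rparr>)"
proof -
  interpret fixed_subbrace B A
    using assms by (simp add: fixed_subbrace_def fixed_subbrace_axioms_def)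
  show ?thesis
  proof (rule brace_ideal_in_subbrace)
    show "lam b c \<in> brace_centraliser B A"
      if "b \<in> brace_idealiser B A" "c \<in> brace_centraliser B A" for b c
      using that lambda_brace_centraliser by (simp add: brace_idealiser_def)
  qed (use assms(2) in \<open>auto intro: subbrace_brace_idealiser subbrace_brace_centraliser
      brace_centraliser_add_normal brace_centraliser_mult_normal
      dest: subsetD[OF brace_centraliser_subset_idealiser]\<close>)
qed

end
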